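(* Let $G$ be a sandpile graph with $n+1$ vertices. The set of zeros $X\subset\mathbb{P}^n$ of the homogeneous toppling ideal $I_h(G)$ is Cayley-Bacharach.
   Context: A directed multigraph $G=(V,E)$ has a finite vertex set $V$ and edge set $E\subseteq V\times V$ with a weight function $\mathrm{wt}:V\times V\to\mathbb{N}$, $\mathrm{wt}(u,v)>0$ iff $(u,v)\in E$ (loops allowed); $\mathrm{outdeg}(v)=\sum_{u\in V}\mathrm{wt}(v,u)$. A sandpile graph $(V,E,s)$ is a directed multigraph with a vertex $s$ (the sink) that is globally accessible: from every vertex there is a directed path to $s$. Identify $V$ with $\{1,\dots,n+1\}$. The Laplacian is $\Delta:\mathbb{Z}V\to\mathbb{Z}V$, $\Delta(v)=\mathrm{outdeg}(v)\,v-\sum_{u\in V}\mathrm{wt}(v,u)\,u$, and $\mathcal{L}=\mathrm{im}(\Delta)$. The homogeneous toppling ideal is $I_h(G)=\mathrm{Span}_{\mathbb{C}}\{x^u-x^v:u,v\in\mathbb{N}^{n+1},\ u-v\in\mathcal{L}\}\subseteq S=\mathbb{C}[x_1,\dots,x_{n+1}]$; its zero set in $\mathbb{P}^n$ is finite. For a finite set $X\subset\mathbb{P}^n$, let $I(X)\subseteq S$ be the ideal generated by homogeneous polynomials vanishing on $X$ and $H_X(d)=\dim_{\mathbb{C}}(S/I(X))_d$. $X$ is Cayley-Bacharach if for each $p\in X$ and each $d\in\mathbb{N}$, $H_{X\setminus\{p\}}(d)=\min\{H_X(d),|X|-1\}$. (Equivalently: every homogeneous polynomial of degree less than the postulation number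 of $X$, i.e. the least $d$ with $H_X(d)=|X|$, that vanishes on all but one point of $X$ vanishes on all of $X$.) *)

theory Defs
  imports
    "HOL-Library.Poly_Mapping"
    "HOL-Algebra.QuotRing"
    "HOL-Algebra.Embedded_Algebras"
    "HOL-Analysis.Cartesian_Space"
begin

text \<open>The vertex set is the finite type \<open>'v\<close>, so \<open>n + 1 = CARD('v)\<close>, and
  \<open>\<int>V\<close> is the free abelian group \<open>'v \<Rightarrow>\<^sub>0 int\<close> of \<^theory>\<open>HOL-Library.Poly_Mapping\<close>.\<close>

locale directed_multigraph =
  fixes E :: "('v::finite \<times> 'v) set" and wt :: "'v \<Rightarrow> 'v \<Rightarrow> nat"
  assumes wt_pos_iff: "wt u v > 0 \<longleftrightarrow> (u, v) \<in> E"

locale sandpile_graph = directed_multigraph E wt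
  for E :: "('v::finite \<times> 'v) set" and wt :: "'v \<Rightarrow> 'v \<Rightarrow> nat" +
  fixes s :: 'v
  assumes sink_globally_accessible: "(v, s) \<in> E\<^sup>*"

definition outdeg :: "('v::finite \<Rightarrow> 'v \<Rightarrow> nat) \<Rightarrow> 'v \<Rightarrow> nat" where
  "outdeg wt v = (\<Sum>u\<in>UNIV. wt v u)"

definition laplacian :: "('v::finite \<Rightarrow> 'v \<Rightarrow> nat) \<Rightarrow> ('v \<Rightarrow>\<^sub>0 int) \<Rightarrow> ('v \<Rightarrow>\<^sub>0 int)" where
  "laplacian wt = frag_extend (\<lambda>v.
     frag_cmul (int (outdeg wt v)) (frag_of v) - (\<Sum>u\<in>UNIV. frag_cmul (int (wt v u)) (frag_of u)))"

definition laplacian_lattice :: "('v::finite \<Rightarrow> 'v \<Rightarrow> nat) \<Rightarrow> ('v \<Rightarrow>\<^sub>0 int) set" where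
  "laplacian_lattice wt = range (laplacian wt)"

text \<open>\<open>S = \<complex>[x\<^sub>v | v \<in> V]\<close> is the monoid algebra of the exponent vectors.\<close>

type_synonym 'v cpoly = "('v \<Rightarrow>\<^sub>0 nat) \<Rightarrow>\<^sub>0 complex"

definition cconst :: "complex \<Rightarrow> 'v::finite cpoly" where
  "cconst c = Poly_Mapping.single 0 c"

definition cmonom :: "('v::finite \<Rightarrow>\<^sub>0 nat) \<Rightarrow> 'v cpoly" where
  "cmonom u = Poly_Mapping.single u 1"

definition cscale :: "complex \<Rightarrow> 'v::finite cpoly \<Rightarrow> 'v cpoly" where
  "cscale c f = cconst c * f"

interpretation cpoly: vector_space "cscale :: complex \<Rightarrow> 'v::finite cpoly \<Rightarrow> 'v cpoly"
  by unfold_locales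
    (simp_all add: cscale_def cconst_def algebra_simps single_add mult_single flip: mult.assoc)

definition peval :: "'v::finite cpoly \<Rightarrow> complex ^ 'v \<Rightarrow> complex" where
  "peval f x = (\<Sum>m\<in>Poly_Mapping.keys f.
     Poly_Mapping.lookup f m * (\<Prod>v\<in>UNIV. (x $ v) ^ Poly_Mapping.lookup m v))"

definition homogeneous_part :: "nat \<Rightarrow> 'v::finite cpoly set" where
  "homogeneous_part d =
     {f. \<forall>m\<in>Poly_Mapping.keys f. (\<Sum>v\<in>UNIV. Poly_Mapping.lookup m v) = d}"

definition toppling_ideal :: "('v::finite \<Rightarrow> 'v \<Rightarrow> nat) \<Rightarrow> 'v cpoly set" where
  "toppling_ideal wt = cpoly.span {cmonom u - cmonom v | u v.
     Poly_Mapping.map int u - Poly_Mapping.map int v \<in> laplacian_lattice wt}"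

text \<open>A point of the projective space is a line through the origin; its homogeneous coordinate
  vectors are the nonzero vectors of the line.\<close>

definition projective_space :: "(complex ^ 'v::finite) set set" where
  "projective_space = {vec.span {x} | x. x \<noteq> 0}"

definition vanishes_at :: "'v::finite cpoly \<Rightarrow> (complex ^ 'v) set \<Rightarrow> bool" where
  "vanishes_at f p \<longleftrightarrow> (\<forall>x\<in>p - {0}. peval f x = 0)"

definition projective_zeros :: "'v::finite cpoly set \<Rightarrow> (complex ^ 'v) set set" where
  "projective_zeros J = {p \<in> projective_space. \<forall>f\<in>J. vanishes_at f p}"

definition cpoly_ring :: "'v::finite cpoly ring" where
  "cpoly_ring = \<lparr>carrier = UNIV, mult = (*), one = 1, zero = 0, add = (+)\<rparr>"

definition vanishing_ideal :: "(complex ^ 'v::finite) set set \<Rightarrow> 'v cpoly set" where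
  "vanishing_ideal X =
     Idl\<^bsub>cpoly_ring\<^esub> {f. (\<exists>d. f \<in> homogeneous_part d) \<and> (\<forall>p\<in>X. vanishes_at f p)}"

text \<open>The degree-\<open>d\<close> part of \<open>S / I(X)\<close> is the image of the homogeneous polynomials of
  degree \<open>d\<close>; its dimension is taken over the image of the constants. For \<open>X = {}\<close> the quotient
  is the zero ring and the dimension is \<open>0\<close>.\<close>

definition hilbert_function :: "(complex ^ 'v::finite) set set \<Rightarrow> nat \<Rightarrow> nat" where
  "hilbert_function X d =
     (let I = vanishing_ideal X; coset = (\<lambda>f. I +>\<^bsub>cpoly_ring\<^esub> f)
      in ring.dim (cpoly_ring Quot I) (coset ` range cconst) (coset ` homogeneous_part d))"

definition cayley_bacharach :: "(complex ^ 'v::finite) set set \<Rightarrow> bool" where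
  "cayley_bacharach X \<longleftrightarrow> finite X \<and> X \<subseteq> projective_space \<and>
     (\<forall>p\<in>X. \<forall>d. hilbert_function (X - {p}) d = min (hilbert_function X d) (card X - 1))"

end

theory Submission
  imports Defs
begin

text \<open>The zero set \<open>X\<close> is homogeneous under a torus, and a homogeneous finite set of points is
  Cayley-Bacharach.

  A zero of the toppling ideal is a vector \<open>x\<close> with \<open>x\<^sup>u = x\<^sup>v\<close> whenever
  \<open>u - v \<in> \<L>\<close>. The sink is globally accessible, so a function that is harmonic off the sink and
  vanishes at the sink is zero (maximum principle), the reduced Laplacian is invertible over the
  rationals, and a positive multiple of \<open>v - s\<close> lies in \<open>\<L>\<close> for every vertex \<open>v\<close>
  (\<open>torsion_mod_lattice\<close>). Consequently the coordinates of a zero agree up to roots of unity of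
  bounded order: none of them is \<open>0\<close>, and \<open>X\<close> is finite. The zeros are therefore the characters
  of \<open>\<int>V / \<L>\<close>, considered up to a common factor. For two zeros \<open>x\<close> and \<open>y\<close> the coordinatewise
  quotient \<open>t = y / x\<close> is again such a character, and multiplication by \<open>t\<close> is a linear map that
  permutes \<open>X\<close> and takes \<open>x\<close> to \<open>y\<close>.

  Say that a form of degree \<open>d\<close> separates \<open>p\<close> from \<open>Y\<close> if it vanishes on \<open>Y\<close> but not at \<open>p\<close>.
  Adding a point \<open>p\<close> to \<open>Y\<close> increases the Hilbert function at \<open>d\<close> by one if a form of degree
  \<open>d\<close> separates \<open>p\<close> from \<open>Y\<close>, and leaves it unchanged otherwise (\<open>hilbert_function_insert\<close>).
  Substituting \<open>t \<cdot> z\<close> for \<open>z\<close> carries a form that separates one point of \<open>X\<close> from the others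
  to a form that does so for another point, so in each degree either all points of \<open>X\<close> can be
  separated or none can. If all can, then \<open>H\<^sub>X(d) = |X|\<close> and the removal of a point decreases the
  value by one; if none can, then \<open>H\<^sub>X(d)\<close> equals \<open>H\<close> of \<open>X\<close> without \<open>p\<close>, which is at most
  \<open>|X| - 1\<close>. In both cases the value without \<open>p\<close> is the required minimum
  (\<open>cayley_bacharach_if_separators_transfer\<close>).\<close>

section \<open>Evaluation of polynomials\<close>

definition monom_at :: "('v::finite \<Rightarrow>\<^sub>0 nat) \<Rightarrow> complex ^ 'v \<Rightarrow> complex" where
  "monom_at m x = (\<Prod>v\<in>UNIV. (x $ v) ^ Poly_Mapping.lookup m v)"

lemma monom_at_zero [simp]: "monom_at 0 x = 1"
  by (simp add: monom_at_def)

lemma monom_at_add: "monom_at (m + k) x = monom_at m x * monom_at k x"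
  by (simp add: monom_at_def lookup_add power_add prod.distrib)

lemma monom_at_single: "monom_at (Poly_Mapping.single v k) x = (x $ v) ^ k"
proof -
  have "monom_at (Poly_Mapping.single v k) x = (\<Prod>w\<in>UNIV. if w = v then (x $ v) ^ k else 1)"
    unfolding monom_at_def by (rule prod.cong) (auto simp: lookup_single)
  then show ?thesis by simp
qed

definition hadamard :: "complex ^ 'v \<Rightarrow> complex ^ 'v \<Rightarrow> complex ^ 'v::finite" where
  "hadamard t x = (\<chi> v. t $ v * x $ v)"

lemma monom_at_hadamard: "monom_at m (hadamard t x) = monom_at m t * monom_at m x"
  by (simp add: hadamard_def monom_at_def power_mult_distrib prod.distrib)

lemma monom_at_scale:
  "monom_at m (c *s x) = c ^ (\<Sum>v\<in>UNIV. Poly_Mapping.lookup m v) * monom_at m x"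
  by (simp add: monom_at_def power_mult_distrib prod.distrib power_sum)

lemma peval_superset:
  assumes "finite A" and "Poly_Mapping.keys f \<subseteq> A"
  shows "peval f x = (\<Sum>m\<in>A. Poly_Mapping.lookup f m * monom_at m x)"
  unfolding peval_def monom_at_def
  using assms by (intro sum.mono_neutral_left) (auto simp: in_keys_iff)

lemma peval_zero [simp]: "peval 0 x = 0"
  by (simp add: peval_def)

lemma peval_add: "peval (f + g) x = peval f x + peval g x"
proof -
  have "peval h x = (\<Sum>m\<in>Poly_Mapping.keys f \<union> Poly_Mapping.keys g.
      Poly_Mapping.lookup h m * monom_at m x)" if "h \<in> {f, g, f + g}" for h
    using that by (intro peval_superset) (auto dest: subsetD[OF keys_add])
  then show ?thesis
    by (simp add: lookup_add distrib_right sum.distrib)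
qed

lemma peval_single: "peval (Poly_Mapping.single m c) x = c * monom_at m x"
  by (subst peval_superset[of "{m}"]) auto

lemma cpoly_induct [case_names zero single_add]:
  assumes "P 0"
    and "\<And>m c f. P f \<Longrightarrow> P (Poly_Mapping.single m c + f)"
  shows "P (f :: 'v::finite cpoly)"
proof (induction f rule: update_induct)
  case (update f m c)
  then have "Poly_Mapping.update m c f = Poly_Mapping.single m c + f"
    by (auto intro!: poly_mapping_eqI simp: lookup_update lookup_add lookup_single in_keys_iff)
  with update assms(2) show ?case by simp
qed fact

lemma peval_mult: "peval (f * g) x = peval f x * peval g x"
proof (induction f rule: cpoly_induct)
  case (single_add m c f)
  have "peval (Poly_Mapping.single m c * g) x = c * monom_at m x * peval g x"
  proof (induction g rule: cpoly_induct)
    case (single_add k d g)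
    then show ?case
      by (simp add: distrib_left peval_add mult_single peval_single monom_at_add)
  qed simp
  with single_add show ?case
    by (simp add: distrib_right peval_add peval_single)
qed simp

lemma peval_cconst [simp]: "peval (cconst c) x = c"
  by (simp add: cconst_def peval_single)

lemma peval_cscale: "peval (cscale c f) x = c * peval f x"
  by (simp add: cscale_def peval_mult)

lemma peval_cmonom: "peval (cmonom m) x = monom_at m x"
  by (simp add: cmonom_def peval_single)

lemma peval_diff: "peval (f - g) x = peval f x - peval g x"
  using peval_add[of "f - g" g x] by simp

lemma peval_homogeneous:
  assumes "f \<in> homogeneous_part d"
  shows "peval f (c *s x) = c ^ d * peval f x"
  using assms unfolding homogeneous_part_def
  by (auto simp: peval_superset[OF finite_keys order_refl] monom_at_scale sum_distrib_left
      intro!: sum.cong)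

lemma subspace_homogeneous_part: "cpoly.subspace (homogeneous_part d)"
proof (rule cpoly.subspaceI)
  show "0 \<in> homogeneous_part d"
    by (simp add: homogeneous_part_def)
next
  fix f g :: "'a cpoly"
  assume "f \<in> homogeneous_part d" and "g \<in> homogeneous_part d"
  then show "f + g \<in> homogeneous_part d"
    unfolding homogeneous_part_def using keys_add[of f g] by blast
next
  fix c and f :: "'a cpoly"
  assume "f \<in> homogeneous_part d"
  moreover have "Poly_Mapping.keys (cscale c f) \<subseteq> Poly_Mapping.keys f"
    using keys_mult[of "cconst c" f] by (auto simp: cscale_def cconst_def split: if_splits)
  ultimately show "cscale c f \<in> homogeneous_part d"
    unfolding homogeneous_part_def by blast
qed

text \<open>The substitution of \<open>t\<^sub>v x\<^sub>v\<close> for each variable \<open>x\<^sub>v\<close>, see \<open>peval_dilate\<close>: it multiplies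
  each coefficient by the value of its monomial at \<open>t\<close>, so that it visibly preserves degrees.\<close>
definition dilate :: "complex ^ 'v \<Rightarrow> 'v::finite cpoly \<Rightarrow> 'v cpoly" where
  "dilate t = Poly_Mapping.mapp (\<lambda>m c. c * monom_at m t)"

lemma keys_dilate: "Poly_Mapping.keys (dilate t f) \<subseteq> Poly_Mapping.keys f"
  unfolding dilate_def by (rule keys_mapp_subset)

lemma lookup_dilate:
  "Poly_Mapping.lookup (dilate t f) m = Poly_Mapping.lookup f m * monom_at m t"
  by (simp add: dilate_def lookup_mapp when_def in_keys_iff)

lemma peval_dilate: "peval (dilate t f) x = peval f (hadamard t x)"
  by (subst peval_superset[OF finite_keys keys_dilate], subst peval_superset[OF finite_keys order_refl])
    (simp add: lookup_dilate monom_at_hadamard mult.assoc)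

lemma homogeneous_dilate:
  assumes "f \<in> homogeneous_part d"
  shows "dilate t f \<in> homogeneous_part d"
  using assms keys_dilate[of t f] by (auto simp: homogeneous_part_def)

definition vanishes_on :: "'v::finite cpoly \<Rightarrow> (complex ^ 'v) set set \<Rightarrow> bool" where
  "vanishes_on f X \<longleftrightarrow> (\<forall>p\<in>X. vanishes_at f p)"

lemma vanishes_on_insert: "vanishes_on f (insert p X) \<longleftrightarrow> vanishes_at f p \<and> vanishes_on f X"
  by (simp add: vanishes_on_def)

lemma vanishes_on_mono: "vanishes_on f X \<Longrightarrow> Y \<subseteq> X \<Longrightarrow> vanishes_on f Y"
  by (auto simp: vanishes_on_def)

lemma subspace_vanishes_on: "cpoly.subspace {f. vanishes_on f X}"
  by (rule cpoly.subspaceI)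
    (auto simp: vanishes_on_def vanishes_at_def peval_add peval_cscale)

lemma subspace_vanishes_at: "cpoly.subspace {f. vanishes_at f p}"
  using subspace_vanishes_on[of "{p}"] by (simp add: vanishes_on_def)

lemma line_rep:
  assumes "p \<in> projective_space"
  obtains x where "p = vec.span {x}" and "x \<noteq> 0" and "x \<in> p"
  using assms unfolding projective_space_def by (auto intro: vec.span_base)

text \<open>A form is zero on a line as soon as it is zero at one nonzero vector of the line, so a single
  representative decides whether it vanishes at a projective point.\<close>
lemma vanishes_at_line:
  assumes "f \<in> homogeneous_part d" and "x \<noteq> 0"
  shows "vanishes_at f (vec.span {x}) \<longleftrightarrow> peval f x = 0"
proof
  assume "vanishes_at f (vec.span {x})"
  with \<open>x \<noteq> 0\<close> show "peval f x = 0"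
    by (simp add: vanishes_at_def vec.span_base)
next
  assume "peval f x = 0"
  with assms(1) show "vanishes_at f (vec.span {x})"
    by (auto simp: vanishes_at_def vec.span_singleton peval_homogeneous)
qed

lemma span_line_eq:
  assumes "y \<in> vec.span {x}" and "y \<noteq> 0"
  shows "vec.span {y} = vec.span {x :: complex ^ 'v::finite}"
proof -
  obtain c where c: "y = c *s x" and "c \<noteq> 0"
    using assms by (auto simp: vec.span_singleton)
  then have "k *s x = (k / c) *s y" for k
    by simp
  then have "vec.span {x} \<subseteq> vec.span {y}"
    by (auto simp: vec.span_singleton)
  moreover have "vec.span {y} \<subseteq> vec.span {x}"
    using assms(1) by (intro vec.span_minimal) auto
  ultimately show ?thesis by simp
qed

section \<open>Complements of the forms that vanish on a finite set\<close>

text \<open>A basis of a linear complement, inside the forms of degree \<open>d\<close>, of the subspace of those that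
  vanish on \<open>X\<close>. Its size is the Hilbert function (\<open>hilbert_function_eq_card\<close>), and it can be
  built up one point at a time.\<close>
definition hilbert_basis :: "(complex ^ 'v::finite) set set \<Rightarrow> nat \<Rightarrow> 'v cpoly set \<Rightarrow> bool" where
  "hilbert_basis X d B \<longleftrightarrow> finite B \<and> cpoly.independent B \<and> B \<subseteq> homogeneous_part d \<and>
     (\<forall>g\<in>cpoly.span B. vanishes_on g X \<longrightarrow> g = 0) \<and>
     (\<forall>f\<in>homogeneous_part d. \<exists>g\<in>cpoly.span B. vanishes_on (f - g) X)"

lemma hilbert_basis_span:
  assumes "hilbert_basis X d B"
  shows "cpoly.span B \<subseteq> homogeneous_part d"
  using assms
  by (intro cpoly.span_minimal subspace_homogeneous_part) (auto simp: hilbert_basis_def)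

definition separator :: "(complex ^ 'v::finite) set set \<Rightarrow> (complex ^ 'v) set \<Rightarrow> nat \<Rightarrow> 'v cpoly \<Rightarrow> bool"
  where "separator Y p d f \<longleftrightarrow> f \<in> homogeneous_part d \<and> vanishes_on f Y \<and> \<not> vanishes_at f p"

text \<open>A separator of \<open>p\<close> is zero modulo the forms that vanish on \<open>Y\<close> but not modulo those that
  also vanish at \<open>p\<close>. The condition at \<open>p\<close> is one linear equation on the forms that vanish on
  \<open>Y\<close>, so the separator is exactly the one new basis element required.\<close>
lemma hilbert_basis_insert_separator:
  assumes B: "hilbert_basis Y d B" and f0: "separator Y p d f0" and p: "p \<in> projective_space"
  shows "f0 \<notin> B" and "hilbert_basis (insert p Y) d (insert f0 B)"
proof -
  obtain x where x: "p = vec.span {x}" "x \<noteq> 0"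
    using p by (rule line_rep)
  have f0': "f0 \<in> homogeneous_part d" "vanishes_on f0 Y" "\<not> vanishes_at f0 p"
    using f0 by (auto simp: separator_def)
  have f0x: "peval f0 x \<noteq> 0"
    using f0' x by (simp add: vanishes_at_line)
  note spanB = hilbert_basis_span[OF B]
  have "f0 \<noteq> 0"
    using f0x by auto
  then have nspan: "f0 \<notin> cpoly.span B"
    using B f0' by (auto simp: hilbert_basis_def)
  then show "f0 \<notin> B"
    by (auto intro: cpoly.span_base)
  have "h = 0" if h: "h \<in> cpoly.span (insert f0 B)" "vanishes_on h (insert p Y)" for h
  proof -
    obtain c where c: "h - cscale c f0 \<in> cpoly.span B"
      using h(1) by (auto simp: cpoly.span_breakdown_eq)
    have "vanishes_on (h - cscale c f0) Y"
      using h(2) f0'(2) subspace_vanishes_on[of Y]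
      by (auto simp: vanishes_on_insert dest: cpoly.subspace_diff cpoly.subspace_scale)
    with c B have "h = cscale c f0"
      by (auto simp: hilbert_basis_def)
    moreover have "peval h x = 0"
      using h(2) x by (simp add: vanishes_on_insert vanishes_at_def vec.span_base)
    ultimately show "h = 0"
      using f0x by (simp add: peval_cscale)
  qed
  moreover have "\<exists>h\<in>cpoly.span (insert f0 B). vanishes_on (f - h) (insert p Y)"
    if f: "f \<in> homogeneous_part d" for f
  proof -
    obtain g where g: "g \<in> cpoly.span B" "vanishes_on (f - g) Y"
      using B f by (auto simp: hilbert_basis_def)
    \<comment> \<open>The multiple of \<open>f0\<close> that corrects the value at \<open>p\<close>; this does not disturb the values on
      \<open>Y\<close>.\<close>
    define c where "c = peval (f - g) x / peval f0 x"
    define h where "h = g + cscale c f0"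
    have "h \<in> cpoly.span (insert f0 B)"
      unfolding h_def cpoly.span_breakdown_eq using g(1) by (intro exI[of _ c]) simp
    moreover have eq: "f - h = (f - g) - cscale c f0"
      by (simp add: h_def)
    have "vanishes_on (f - h) Y"
      unfolding eq using g(2) f0'(2) subspace_vanishes_on[of Y]
      by (auto dest: cpoly.subspace_diff cpoly.subspace_scale)
    moreover have "f - h \<in> homogeneous_part d"
      unfolding eq using f g(1) spanB f0'(1)
      by (intro cpoly.subspace_diff cpoly.subspace_scale subspace_homogeneous_part) auto
    moreover have "peval (f - h) x = 0"
      unfolding eq using f0x by (simp add: peval_diff peval_cscale c_def)
    ultimately show ?thesis
      using x by (intro bexI[of _ h]) (simp_all add: vanishes_on_insert vanishes_at_line)
  qed
  ultimately show "hilbert_basis (insert p Y) d (insert f0 B)"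
    using B f0'(1) nspan by (auto simp: hilbert_basis_def cpoly.independent_insert)
qed

text \<open>If nothing separates \<open>p\<close> from \<open>Y\<close>, the forms of degree \<open>d\<close> that vanish on \<open>Y\<close> are the same as
  those that vanish on \<open>Y\<close> and \<open>p\<close>, and a complement of them stays one.\<close>
lemma hilbert_basis_insert_no_separator:
  assumes B: "hilbert_basis Y d B" and no: "\<nexists>f. separator Y p d f"
  shows "hilbert_basis (insert p Y) d B"
proof -
  note spanB = hilbert_basis_span[OF B]
  have "\<exists>g\<in>cpoly.span B. vanishes_on (f - g) (insert p Y)" if f: "f \<in> homogeneous_part d" for f
  proof -
    obtain g where g: "g \<in> cpoly.span B" "vanishes_on (f - g) Y"
      using B f by (auto simp: hilbert_basis_def)
    have "f - g \<in> homogeneous_part d"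
      using f g(1) spanB by (intro cpoly.subspace_diff subspace_homogeneous_part) auto
    with g no show ?thesis
      by (auto simp: separator_def vanishes_on_insert)
  qed
  with B show ?thesis
    by (auto simp: hilbert_basis_def vanishes_on_insert)
qed

lemma hilbert_basis_empty: "hilbert_basis {} d {}"
  by (auto simp: hilbert_basis_def vanishes_on_def cpoly.independent_empty)

lemma hilbert_basis_exists:
  assumes "finite X" and "X \<subseteq> projective_space"
  shows "\<exists>B. hilbert_basis X d B"
  using assms
proof (induction X rule: finite_induct)
  case empty
  then show ?case using hilbert_basis_empty by blast
next
  case (insert p Y)
  then show ?case
    using hilbert_basis_insert_separator(2) hilbert_basis_insert_no_separator
    by (metis insert_subset)
qed

section \<open>The Hilbert function as the size of a complement\<close>

lemma cpoly_ring_simps [simp]: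
  "carrier cpoly_ring = UNIV" "f \<otimes>\<^bsub>cpoly_ring\<^esub> g = f * g" "f \<oplus>\<^bsub>cpoly_ring\<^esub> g = f + g"
  "\<one>\<^bsub>cpoly_ring\<^esub> = 1" "\<zero>\<^bsub>cpoly_ring\<^esub> = 0"
  by (simp_all add: cpoly_ring_def)

lemma cring_cpoly_ring: "cring cpoly_ring"
  by (intro cringI abelian_groupI comm_monoidI)
    (auto simp: algebra_simps intro: exI[of _ "- x" for x])

lemma ring_cpoly_ring: "ring cpoly_ring"
  using cring_cpoly_ring by (rule cring.axioms)

lemma a_minus_cpoly_ring: "\<ominus>\<^bsub>cpoly_ring\<^esub> f = - f"
  by (rule abelian_group.minus_equality)
    (auto intro: ring.is_abelian_group ring_cpoly_ring)

lemma coset_eq_iff: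
  assumes "ideal I cpoly_ring"
  shows "I +>\<^bsub>cpoly_ring\<^esub> f = I +>\<^bsub>cpoly_ring\<^esub> g \<longleftrightarrow> f - g \<in> I"
  using ring.quotient_eq_iff_same_a_r_cos[OF ring_cpoly_ring assms, of f g]
  by (simp add: a_minus_def a_minus_cpoly_ring)

lemma ideal_vanishing: "ideal {f. vanishes_on f X} cpoly_ring"
proof (rule idealI[OF ring_cpoly_ring])
  have "vanishes_on (f + g) X" and "vanishes_on (- f) X" and "vanishes_on 0 X"
    if "vanishes_on f X" "vanishes_on g X" for f g
    using that subspace_vanishes_on[of X]
    by (auto dest: cpoly.subspace_add cpoly.subspace_neg cpoly.subspace_0)
  moreover have "vanishes_on 0 X"
    using cpoly.subspace_0[OF subspace_vanishes_on[of X]] by simp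
  ultimately show "subgroup {f. vanishes_on f X} (add_monoid cpoly_ring)"
    by (intro group.subgroupI abelian_group.a_group ring.is_abelian_group ring_cpoly_ring)
      (auto simp: a_minus_cpoly_ring[unfolded a_inv_def, simplified])
qed (auto simp: vanishes_on_def vanishes_at_def peval_mult)

lemma ideal_vanishing_ideal: "ideal (vanishing_ideal X) cpoly_ring"
  unfolding vanishing_ideal_def by (rule ring.genideal_ideal[OF ring_cpoly_ring]) simp

lemma vanishing_ideal_vanishes: "f \<in> vanishing_ideal X \<Longrightarrow> vanishes_on f X"
  using ring.genideal_minimal[OF ring_cpoly_ring ideal_vanishing[of X],
      of "{f. (\<exists>d. f \<in> homogeneous_part d) \<and> (\<forall>p\<in>X. vanishes_at f p)}"]
  by (auto simp: vanishing_ideal_def vanishes_on_def)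

text \<open>The degree-\<open>d\<close> part of the vanishing ideal contains nothing but the generators of degree \<open>d\<close>:
  evaluation is a ring homomorphism, so every element of the ideal still vanishes on \<open>X\<close>.\<close>
lemma homogeneous_in_vanishing_ideal:
  assumes "f \<in> homogeneous_part d"
  shows "f \<in> vanishing_ideal X \<longleftrightarrow> vanishes_on f X"
proof
  assume "vanishes_on f X"
  with assms show "f \<in> vanishing_ideal X"
    unfolding vanishing_ideal_def
    by (intro subsetD[OF ring.genideal_self[OF ring_cpoly_ring]]) (auto simp: vanishes_on_def)
qed (rule vanishing_ideal_vanishes)

lemma subfield_constants: "subfield (range cconst) (cpoly_ring :: 'v::finite cpoly ring)"
proof (rule ring.subfield_iff(1)[OF ring_cpoly_ring])
  have cc: "cconst a + cconst b = cconst (a + b)" "cconst a * cconst b = cconst (a * b)"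
    "1 = cconst 1" "0 = cconst 0" for a b
    by (simp_all add: cconst_def single_add mult_single)
  let ?K = "(cpoly_ring :: 'v cpoly ring) \<lparr>carrier := range cconst\<rparr>"
  have eq: "cconst a = cconst b \<longleftrightarrow> a = b" for a b
    by (metis peval_cconst)
  have "cring ?K"
    by (intro cringI abelian_groupI comm_monoidI)
      (auto simp: cc eq algebra_simps intro: exI[of _ "- x" for x])
  then show "field ?K"
  proof (rule cring.cring_fieldI2)
    show "\<zero>\<^bsub>?K\<^esub> \<noteq> \<one>\<^bsub>?K\<^esub>"
      by (simp add: cc eq)
    show "\<exists>b\<in>carrier ?K. a \<otimes>\<^bsub>?K\<^esub> b = \<one>\<^bsub>?K\<^esub>" if a: "a \<in> carrier ?K" "a \<noteq> \<zero>\<^bsub>?K\<^esub>"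
      for a :: "'v cpoly"
    proof -
      obtain c where c: "a = cconst c" "c \<noteq> 0"
        using a by (auto simp: cc(4))
      then show ?thesis
        by (intro bexI[of _ "cconst (1 / c)"]) (simp_all add: cc eq)
    qed
  qed
qed simp

text \<open>When \<open>X\<close> is empty the quotient is the zero ring, where the constants do not form a field and
  the uniqueness of dimension over a field does not apply. There the dimension is unique because
  no vector lies outside a space that contains \<open>\<zero>\<close>.\<close>
lemma (in ring) dimension_zero_space:
  assumes "carrier R = {\<zero>}" and "dimension n K {\<zero>}"
  shows "n = 0"
  using assms(2)
proof (cases rule: dimension.cases)
  case (Suc_dim v E m)
  have "\<zero> \<in> E"
    using Suc_dim(5)
  proof (induction rule: dimension.induct)
    case (Suc_dim v E n K)
    then show ?case using assms(1) by auto
  qed simp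
  moreover have "v = \<zero>"
    using Suc_dim(3) assms(1) by auto
  ultimately show ?thesis
    using Suc_dim(4) by simp
qed simp

text \<open>The inductive definition of dimension adjoins one vector at a time. The coset of a basis element
  \<open>b\<close> lies outside the image of the span of the others: otherwise a nonzero element of the whole
  span would vanish on \<open>X\<close>.\<close>
lemma quotient_dimension:
  fixes X :: "(complex ^ 'v::finite) set set"
  defines "I \<equiv> vanishing_ideal X"
  assumes "finite B" and "cpoly.independent B" and "B \<subseteq> homogeneous_part d"
    and "\<And>g. g \<in> cpoly.span B \<Longrightarrow> vanishes_on g X \<Longrightarrow> g = 0"
  shows "ring.dimension (cpoly_ring Quot I) (card B)
    ((\<lambda>f. I +>\<^bsub>cpoly_ring\<^esub> f) ` range cconst) ((\<lambda>f. I +>\<^bsub>cpoly_ring\<^esub> f) ` cpoly.span B)"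
proof -
  let ?Q = "cpoly_ring Quot I"
  define h where "h = (\<lambda>f. I +>\<^bsub>cpoly_ring\<^esub> f)"
  have I: "ideal I cpoly_ring"
    unfolding I_def by (rule ideal_vanishing_ideal)
  interpret h: ring_hom_ring cpoly_ring ?Q h
    unfolding h_def by (rule ideal.rcos_ring_hom_ring[OF I])
  have h_eq: "h f = h g \<Longrightarrow> vanishes_on (f - g) X" for f g
    using coset_eq_iff[OF I, of f g] vanishing_ideal_vanishes[of "f - g" X]
    by (simp add: h_def I_def)
  have "h.S.dimension (card B) (h ` range cconst) (h ` cpoly.span B)"
    using assms(2-5)
  proof (induction B rule: finite_induct)
    case empty
    have "h ` cpoly.span {} = {\<zero>\<^bsub>?Q\<^esub>}"
      using h.hom_zero by simp
    then show ?case
      using h.S.dimension.zero_dim by simp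
  next
    case (insert b B)
    have sub: "cpoly.span B \<subseteq> cpoly.span (insert b B)"
      by (intro cpoly.span_mono) auto
    have nspan: "b \<notin> cpoly.span B" and ind: "cpoly.independent B"
      using insert.prems(1) insert.hyps(2) by (auto simp: cpoly.independent_insert)
    have dim: "h.S.dimension (card B) (h ` range cconst) (h ` cpoly.span B)"
      using insert.prems sub by (intro insert.IH ind) auto
    have "h b \<notin> h ` cpoly.span B"
    proof
      assume "h b \<in> h ` cpoly.span B"
      then obtain g where g: "g \<in> cpoly.span B" "h b = h g" by auto
      have "b - g \<in> cpoly.span (insert b B)"
        using g(1) sub by (intro cpoly.span_diff) (auto intro: cpoly.span_base)
      with h_eq[OF g(2)] insert.prems(3) have "b - g = 0" by blast
      with g(1) nspan show False by simp
    qed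
    then have "h.S.dimension (Suc (card B)) (h ` range cconst)
        (h.S.line_extension (h ` range cconst) (h b) (h ` cpoly.span B))"
      using dim by (intro h.S.dimension.Suc_dim) auto
    also have "h.S.line_extension (h ` range cconst) (h b) (h ` cpoly.span B)
        = h ` cpoly.span (insert b B)"
    proof -
      have "h (cconst c) \<otimes>\<^bsub>?Q\<^esub> h b \<oplus>\<^bsub>?Q\<^esub> h g = h (cscale c b + g)" for c g
        using h.hom_mult[of "cconst c" b] h.hom_add[of "cconst c * b" g]
        by (simp add: cscale_def)
      then have "h.S.line_extension (h ` range cconst) (h b) (h ` cpoly.span B)
          = {h (cscale c b + g) | c g. g \<in> cpoly.span B}"
        by (force simp: h.S.line_extension_def set_add_def' r_coset_def)
      also have "\<dots> = h ` {f. \<exists>c. f - cscale c b \<in> cpoly.span B}"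
        by (auto simp: image_iff) (metis add_diff_cancel_left' diff_add_cancel add.commute)+
      finally show ?thesis
        by (simp add: cpoly.span_insert)
    qed
    finally show ?case
      using insert.hyps by simp
  qed
  then show ?thesis
    by (simp add: h_def)
qed

text \<open>By the complement property every form is congruent to an element of the span of \<open>B\<close>, so the image
  of the span is the whole graded piece and \<open>quotient_dimension\<close> gives its dimension.\<close>
lemma hilbert_function_eq_card:
  assumes B: "hilbert_basis X d B"
  shows "hilbert_function X d = card B"
proof -
  define I where "I = vanishing_ideal X"
  let ?Q = "cpoly_ring Quot I"
  define h where "h = (\<lambda>f. I +>\<^bsub>cpoly_ring\<^esub> f)"
  have I: "ideal I cpoly_ring"
    unfolding I_def by (rule ideal_vanishing_ideal)
  interpret h: ring_hom_ring cpoly_ring ?Q h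
    unfolding h_def by (rule ideal.rcos_ring_hom_ring[OF I])
  have h_eq: "h f = h g \<longleftrightarrow> f - g \<in> I" for f g
    unfolding h_def by (rule coset_eq_iff[OF I])
  note spanB = hilbert_basis_span[OF B]
  have dim: "h.S.dimension (card B) (h ` range cconst) (h ` cpoly.span B)"
    unfolding h_def I_def using B by (intro quotient_dimension) (auto simp: hilbert_basis_def)
  have "h ` homogeneous_part d = h ` cpoly.span B"
  proof
    show "h ` homogeneous_part d \<subseteq> h ` cpoly.span B"
    proof
      fix y assume "y \<in> h ` homogeneous_part d"
      then obtain f where f: "f \<in> homogeneous_part d" "y = h f" by auto
      then obtain g where g: "g \<in> cpoly.span B" "vanishes_on (f - g) X"
        using B by (auto simp: hilbert_basis_def)
      have "f - g \<in> homogeneous_part d"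
        using f g spanB by (intro cpoly.subspace_diff subspace_homogeneous_part) auto
      with g(2) have "f - g \<in> I"
        by (simp add: I_def homogeneous_in_vanishing_ideal)
      with f g(1) show "y \<in> h ` cpoly.span B"
        by (auto simp: h_eq)
    qed
  qed (use spanB in auto)
  then have H: "hilbert_function X d = h.S.dim (h ` range cconst) (h ` cpoly.span B)"
    by (simp add: hilbert_function_def Let_def I_def h_def)
  show ?thesis
  \<comment> \<open>The constants embed as a field into the quotient unless the quotient is the zero ring.\<close>
  proof (cases "1 \<in> I")
    case True
    then have "I = UNIV"
      using ideal.one_imp_carrier[OF I] by simp
    then have "vanishes_on f X" for f
      using vanishing_ideal_vanishes[of f X] by (simp add: I_def)
    then have "B \<subseteq> {0}"
      using B by (auto simp: hilbert_basis_def intro: cpoly.span_base)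
    then have "B = {}"
      using B cpoly.dependent_zero[of B] by (auto simp: hilbert_basis_def)
    have "\<one>\<^bsub>?Q\<^esub> = \<zero>\<^bsub>?Q\<^esub>"
      using h_eq[of 1 0] h.hom_one h.hom_zero True by simp
    then have "carrier ?Q = {\<zero>\<^bsub>?Q\<^esub>}"
      by (rule h.S.one_zeroD)
    then have "n = 0" if "h.S.dimension n (h ` range cconst) {\<zero>\<^bsub>?Q\<^esub>}" for n
      using that by (rule h.S.dimension_zero_space)
    then have "h.S.dim (h ` range cconst) {\<zero>\<^bsub>?Q\<^esub>} = 0"
      unfolding h.S.dim_def by (intro the_equality) auto
    with H show ?thesis
      using h.hom_zero by (simp add: \<open>B = {}\<close>)
  next
    case False
    have "\<one>\<^bsub>?Q\<^esub> \<noteq> \<zero>\<^bsub>?Q\<^esub>"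
      using h_eq[of 1 0] h.hom_one h.hom_zero False by simp
    then have "subfield (h ` range cconst) ?Q"
      by (rule h.img_is_subfield(2)[OF subfield_constants])
    from h.S.dimI[OF this dim] show ?thesis
      by (simp add: H over_def)
  qed
qed

section \<open>A symmetry criterion for the Cayley-Bacharach property\<close>

text \<open>Vanishing at \<open>p\<close> is a single linear condition on the forms that vanish on \<open>Y\<close>; it is a
  nontrivial one exactly if some separator exists.\<close>
lemma hilbert_function_insert:
  assumes "finite Y" and "Y \<subseteq> projective_space" and "p \<in> projective_space"
  shows "hilbert_function (insert p Y) d =
    hilbert_function Y d + (if \<exists>f. separator Y p d f then 1 else 0)"
proof -
  obtain B where B: "hilbert_basis Y d B"
    using hilbert_basis_exists assms by blast
  show ?thesis
  proof (cases "\<exists>f. separator Y p d f")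
    case True
    then obtain f where f: "separator Y p d f" by blast
    have "hilbert_function (insert p Y) d = card (insert f B)"
      by (intro hilbert_function_eq_card hilbert_basis_insert_separator B f assms)
    moreover have "f \<notin> B"
      by (rule hilbert_basis_insert_separator(1)[OF B f assms(3)])
    moreover have "finite B"
      using B by (simp add: hilbert_basis_def)
    ultimately show ?thesis
      using True hilbert_function_eq_card[OF B] by simp
  next
    case False
    then have "hilbert_basis (insert p Y) d B"
      by (intro hilbert_basis_insert_no_separator B)
    with False B show ?thesis
      by (simp add: hilbert_function_eq_card)
  qed
qed

lemma hilbert_function_empty [simp]: "hilbert_function {} d = 0"
  using hilbert_function_eq_card[OF hilbert_basis_empty] by simp

lemma hilbert_function_le_card:
  assumes "finite X" and "X \<subseteq> projective_space"
  shows "hilbert_function X d \<le> card X"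
  using assms by (induction X rule: finite_induct) (auto simp: hilbert_function_insert)

lemma separator_mono: "separator X p d f \<Longrightarrow> Y \<subseteq> X \<Longrightarrow> separator Y p d f"
  by (auto simp: separator_def intro: vanishes_on_mono)

text \<open>A separator of \<open>p\<close> from \<open>X - {p}\<close> also separates \<open>p\<close> from any smaller set. Hence each point
  contributes \<open>1\<close> when the points of \<open>X\<close> are added one after the other.\<close>
lemma hilbert_function_eq_card_if_separators:
  assumes "finite X" and "X \<subseteq> projective_space"
    and "\<And>p. p \<in> X \<Longrightarrow> \<exists>f. separator (X - {p}) p d f"
  shows "hilbert_function X d = card X"
  using assms
proof (induction X rule: finite_induct)
  case (insert p Y)
  have "\<exists>f. separator (Y - {q}) q d f" if "q \<in> Y" for q
    using insert.prems(2)[of q] that insert.hyps(2) by (blast intro: separator_mono)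
  moreover have "\<exists>f. separator Y p d f"
    using insert.prems(2)[of p] insert.hyps(2) by simp
  ultimately show ?case
    using insert by (simp add: hilbert_function_insert)
qed simp

text \<open>In each degree, by the transfer assumption, either every point can be separated from the rest or
  none can. In the first case the minimum is \<open>|X| - 1\<close>, in the second it is the value of the
  Hilbert function of \<open>X\<close>.\<close>
theorem cayley_bacharach_if_separators_transfer:
  assumes fin: "finite X" and proj: "X \<subseteq> projective_space"
    and transfer: "\<And>p q d f. p \<in> X \<Longrightarrow> q \<in> X \<Longrightarrow> separator (X - {q}) q d f
      \<Longrightarrow> \<exists>g. separator (X - {p}) p d g"
  shows "cayley_bacharach X"
  unfolding cayley_bacharach_def
proof (intro conjI ballI allI fin proj)
  fix p d
  assume p: "p \<in> X"
  have step: "hilbert_function X d =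
      hilbert_function (X - {p}) d + (if \<exists>f. separator (X - {p}) p d f then 1 else 0)"
    using hilbert_function_insert[of "X - {p}" p d] fin proj p by (simp add: insert_absorb subset_iff)
  have card: "card (X - {p}) = card X - 1" "card X > 0"
    using fin p by (auto simp: card_gt_0_iff)
  show "hilbert_function (X - {p}) d = min (hilbert_function X d) (card X - 1)"
  proof (cases "\<exists>f. separator (X - {p}) p d f")
    case True
    with transfer p have "hilbert_function X d = card X"
      by (intro hilbert_function_eq_card_if_separators fin proj) blast
    with step True show ?thesis by simp
  next
    case False
    then show ?thesis
      using step card hilbert_function_le_card[of "X - {p}" d] fin proj
      by (auto simp: subset_iff min_absorb1)
  qed
qed

section \<open>Torsion modulo the Laplacian lattice\<close>

lemma common_denominator:
  fixes q :: "'a \<Rightarrow> rat"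
  assumes "finite A"
  obtains k :: nat and a where "k > 0" and "\<And>w. w \<in> A \<Longrightarrow> of_nat k * q w = of_int (a w)"
proof -
  define D where "D w = snd (quotient_of (q w))" for w
  define k where "k = nat (\<Prod>w\<in>A. D w)"
  have pos: "D w > 0" for w
    by (simp add: D_def quotient_of_denom_pos')
  have "of_nat k * q w = of_int ((\<Prod>u\<in>A - {w}. D u) * fst (quotient_of (q w)))"
    if "w \<in> A" for w
  proof -
    have "of_nat k = (of_int (\<Prod>w\<in>A. D w) :: rat)"
      unfolding k_def using pos by (simp add: prod_nonneg less_imp_le)
    also have "(\<Prod>w\<in>A. D w) = D w * (\<Prod>u\<in>A - {w}. D u)"
      by (rule prod.remove[OF assms that])
    finally have "of_nat k = (of_int (D w) * of_int (\<Prod>u\<in>A - {w}. D u) :: rat)"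
      by simp
    moreover have "q w * of_int (D w) = of_int (fst (quotient_of (q w)))"
      using pos[of w] quotient_of_div[of "q w" "fst (quotient_of (q w))" "D w"]
      by (simp add: D_def nonzero_eq_divide_eq)
    ultimately show ?thesis
      by (simp add: ac_simps)
  qed
  moreover have "k > 0"
    unfolding k_def using pos by (simp add: prod_pos)
  ultimately show ?thesis by (rule that[rotated])
qed

lemma lookup_sum_apply:
  fixes f :: "'a \<Rightarrow> 'b \<Rightarrow>\<^sub>0 int"
  shows "Poly_Mapping.lookup (sum f A) u = (\<Sum>a\<in>A. Poly_Mapping.lookup (f a) u)"
  by (induction A rule: infinite_finite_induct) (simp_all add: lookup_add)

lemma lookup_laplacian:
  "Poly_Mapping.lookup (laplacian wt c) u =
     (\<Sum>w\<in>UNIV. Poly_Mapping.lookup c w *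
        ((if w = u then int (outdeg wt w) else 0) - int (wt w u)))"
proof -
  have "(\<Sum>u'\<in>UNIV. int (wt w u') * Poly_Mapping.lookup (frag_of u') u) = int (wt w u)" for w
  proof -
    have "(\<Sum>u'\<in>UNIV. int (wt w u') * Poly_Mapping.lookup (frag_of u') u)
        = (\<Sum>u'\<in>UNIV. if u' = u then int (wt w u) else 0)"
      by (rule sum.cong) (auto simp: lookup_single)
    then show ?thesis by simp
  qed
  then show ?thesis
    unfolding laplacian_def frag_extend_def
    by (subst lookup_sum_apply)
      (auto simp: lookup_sum_apply lookup_minus lookup_single in_keys_iff
        intro!: sum.mono_neutral_cong_left)
qed

lemma sum_laplacian: "(\<Sum>u\<in>UNIV. Poly_Mapping.lookup (laplacian wt c) u) = 0"
proof -
  have "(\<Sum>u\<in>UNIV. Poly_Mapping.lookup (laplacian wt c) u) =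
      (\<Sum>w\<in>UNIV. Poly_Mapping.lookup c w *
        (\<Sum>u\<in>UNIV. (if w = u then int (outdeg wt w) else 0) - int (wt w u)))"
    unfolding lookup_laplacian by (subst sum.swap) (simp add: sum_distrib_left)
  also have "\<dots> = 0"
    by (simp add: sum_subtractf outdeg_def)
  finally show ?thesis .
qed

context sandpile_graph
begin

text \<open>Maximum principle: the value at \<open>v \<noteq> s\<close> is a weighted average of the values at the
  out-neighbours of \<open>v\<close>, so a maximum at \<open>v\<close> is also attained at these neighbours. It propagates
  along a path to the sink, where the value is \<open>0\<close>.\<close>
lemma harmonic_le_zero:
  fixes h :: "'v \<Rightarrow> rat"
  assumes sink: "h s = 0"
    and harm: "\<And>v. v \<noteq> s \<Longrightarrow> (\<Sum>u\<in>UNIV. of_nat (wt v u) * (h v - h u)) = 0"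
  shows "h v \<le> 0"
proof -
  define m where "m = Max (range h)"
  have le: "h u \<le> m" for u
    by (simp add: m_def)
  have "m \<in> range h"
    unfolding m_def by (rule Max_in) auto
  then obtain v0 where v0: "h v0 = m"
    by auto
  have "h s = m"
    using sink_globally_accessible[of v0] v0
  proof (induction rule: converse_rtrancl_induct)
    case (step v u)
    show ?case
    proof (cases "v = s")
      case False
      have "\<forall>u\<in>UNIV. of_nat (wt v u) * (h v - h u) = 0"
        using harm[OF False] step.prems le
        by (subst (asm) sum_nonneg_eq_0_iff) auto
      moreover have "wt v u > 0"
        using step.hyps(1) by (simp add: wt_pos_iff)
      ultimately have "h u = m"
        using step.prems by (metis UNIV_I eq_iff_diff_eq_0 mult_eq_0_iff not_less0 of_nat_eq_0_iff)
      then show ?thesis by (rule step.IH)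
    qed (use step.prems in simp)
  qed simp
  with le sink show ?thesis by simp
qed

lemma harmonic_eq_zero:
  fixes h :: "'v \<Rightarrow> rat"
  assumes sink: "h s = 0"
    and harm: "\<And>v. v \<noteq> s \<Longrightarrow> (\<Sum>u\<in>UNIV. of_nat (wt v u) * (h v - h u)) = 0"
  shows "h v = 0"
proof -
  have "h v \<le> 0"
    using assms by (rule harmonic_le_zero)
  moreover have "- h v \<le> 0"
  proof (rule harmonic_le_zero)
    show "(\<Sum>u\<in>UNIV. of_nat (wt v u) * (- h v - - h u)) = 0" if "v \<noteq> s" for v
      using harm[OF that] by (simp add: algebra_simps sum_subtractf)
  qed (simp add: sink)
  ultimately show ?thesis by simp
qed

text \<open>The lattice has finite index in the vectors of degree zero. By the maximum principle the matrix
  \<open>M\<close>, the Laplacian with the row of the sink replaced by a unit vector, is invertible over the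
  rationals. Clearing denominators in \<open>M\<^sup>-\<^sup>1 M = 1\<close> writes \<open>k v\<close> as an integer combination of the
  vectors \<open>\<Delta>(w)\<close>, for \<open>w \<noteq> s\<close>, and of \<open>s\<close>; comparing degrees shows that the coefficient of \<open>s\<close>
  is \<open>k\<close>.\<close>
lemma torsion_mod_lattice:
  obtains k :: nat where "k > 0"
    and "Poly_Mapping.single v (int k) - Poly_Mapping.single s (int k) \<in> laplacian_lattice wt"
proof -
  define M :: "rat ^ 'v ^ 'v" where
    "M = (\<chi> w u. if w = s then (if u = s then 1 else 0)
       else (if w = u then of_nat (outdeg wt w) else 0) - of_nat (wt w u))"
  have "x = 0" if x: "M *v x = 0" for x
  proof -
    have comp: "(\<Sum>u\<in>UNIV. M $ w $ u * x $ u) = 0" for w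
      using x by (simp add: vec_eq_iff matrix_vector_mult_def)
    have "x $ u = 0" for u
    proof (rule harmonic_eq_zero[where h = "\<lambda>u. x $ u"])
      show "x $ s = 0"
        using comp[of s] by (simp add: M_def if_distrib[of "\<lambda>c. c * _"] cong: if_cong)
      show "(\<Sum>u\<in>UNIV. of_nat (wt w u) * (x $ w - x $ u)) = 0" if "w \<noteq> s" for w
      proof -
        have "(\<Sum>u\<in>UNIV. M $ w $ u * x $ u)
            = of_nat (outdeg wt w) * x $ w - (\<Sum>u\<in>UNIV. of_nat (wt w u) * x $ u)"
          using that by (simp add: M_def left_diff_distrib sum_subtractf
              if_distrib[of "\<lambda>c. c * _"] cong: if_cong)
        also have "\<dots> = (\<Sum>u\<in>UNIV. of_nat (wt w u) * (x $ w - x $ u))"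
          by (simp add: outdeg_def right_diff_distrib sum_subtractf sum_distrib_right)
        finally show ?thesis using comp[of w] by simp
      qed
    qed
    then show ?thesis by (simp add: vec_eq_iff)
  qed
  then obtain B :: "rat ^ 'v ^ 'v" where B: "B ** M = mat 1"
    using matrix_left_invertible_ker[of M] by blast
  obtain k :: nat and a where k: "k > 0" and a: "\<And>w. of_nat k * B $ v $ w = of_int (a w)"
    using common_denominator[of UNIV "\<lambda>w. B $ v $ w"] by auto
  define c :: "'v \<Rightarrow>\<^sub>0 int" where "c = (\<Sum>w\<in>UNIV - {s}. frag_cmul (a w) (frag_of w))"
  have c: "Poly_Mapping.lookup c w = (if w = s then 0 else a w)" for w
  proof -
    have "Poly_Mapping.lookup c w = (\<Sum>u\<in>UNIV - {s}. if u = w then a w else 0)"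
      unfolding c_def lookup_sum_apply by (rule sum.cong) (auto simp: lookup_single)
    then show ?thesis by simp
  qed
  have lap: "Poly_Mapping.lookup (laplacian wt c) u
      = (if u = v then int k else 0) - (if u = s then a s else 0)" for u
  proof -
    have "of_int (Poly_Mapping.lookup (laplacian wt c) u) + (if u = s then of_int (a s) else 0)
        = (\<Sum>w\<in>UNIV. of_int (a w) * M $ w $ u)"
    proof -
      have "(\<Sum>w\<in>UNIV. of_int (a w) * M $ w $ u)
          = (\<Sum>w\<in>UNIV. (if w = s then (if u = s then of_int (a s) else 0) else 0)
             + of_int (Poly_Mapping.lookup c w *
                ((if w = u then int (outdeg wt w) else 0) - int (wt w u))))"
        by (rule sum.cong) (auto simp: M_def c)
      then show ?thesis
        by (simp add: sum.distrib lookup_laplacian)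
    qed
    also have "\<dots> = of_nat k * (\<Sum>w\<in>UNIV. B $ v $ w * M $ w $ u)"
      by (simp add: a[symmetric] sum_distrib_left mult.assoc)
    also have "(\<Sum>w\<in>UNIV. B $ v $ w * M $ w $ u) = (B ** M) $ v $ u"
      by (simp add: matrix_matrix_mult_def)
    also have "of_nat k * (B ** M) $ v $ u = (if u = v then of_int (int k) else 0)"
      by (simp add: B mat_def)
    finally have "(of_int (Poly_Mapping.lookup (laplacian wt c) u) :: rat)
        = of_int ((if u = v then int k else 0) - (if u = s then a s else 0))"
      by (auto split: if_splits)
    then show ?thesis
      by (simp only: of_int_eq_iff)
  qed
  have "int k = a s"
    using sum_laplacian[of wt c] by (simp add: lap sum_subtractf)
  then have "laplacian wt c = Poly_Mapping.single v (int k) - Poly_Mapping.single s (int k)"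
    by (intro poly_mapping_eqI) (auto simp: lap lookup_minus lookup_single)
  with k show ?thesis
    by (intro that[of k]) (auto simp: laplacian_lattice_def intro: rangeI[of _ c] sym)
qed

end

section \<open>The zeros of the toppling ideal\<close>

text \<open>It suffices to test the binomials that span the ideal. Asking for the monomial identities at every
  nonzero vector of the line keeps the condition independent of the degrees of \<open>u\<close> and \<open>v\<close>.\<close>
lemma zeros_iff:
  "p \<in> projective_zeros (toppling_ideal wt) \<longleftrightarrow> p \<in> projective_space \<and>
    (\<forall>x\<in>p - {0}. \<forall>u v. Poly_Mapping.map int u - Poly_Mapping.map int v \<in> laplacian_lattice wt
       \<longrightarrow> monom_at u x = monom_at v x)"
proof -
  let ?G = "{cmonom u - cmonom v | u v.
     Poly_Mapping.map int u - Poly_Mapping.map int v \<in> laplacian_lattice wt}"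
  have "(\<forall>f\<in>cpoly.span ?G. vanishes_at f p) \<longleftrightarrow> (\<forall>f\<in>?G. vanishes_at f p)"
    using cpoly.span_minimal[OF _ subspace_vanishes_at, of ?G p] cpoly.span_base[of _ ?G]
    by blast
  also have "\<dots> \<longleftrightarrow> (\<forall>x\<in>p - {0}. \<forall>u v.
      Poly_Mapping.map int u - Poly_Mapping.map int v \<in> laplacian_lattice wt
       \<longrightarrow> monom_at u x = monom_at v x)"
    by (fastforce simp: vanishes_at_def peval_diff peval_cmonom)
  finally show ?thesis
    by (simp add: projective_zeros_def toppling_ideal_def)
qed

context sandpile_graph
begin

abbreviation "zeros \<equiv> projective_zeros (toppling_ideal wt)"

text \<open>The exponent depends on the vertex only, not on the zero; this uniformity is what makes the zero
  set finite.\<close>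
lemma zeros_coordinates:
  obtains k :: nat where "k > 0"
    and "\<And>p x. p \<in> zeros \<Longrightarrow> x \<in> p \<Longrightarrow> x \<noteq> 0 \<Longrightarrow> (x $ v) ^ k = (x $ s) ^ k"
proof -
  obtain k :: nat where k: "k > 0"
    and L: "Poly_Mapping.single v (int k) - Poly_Mapping.single s (int k) \<in> laplacian_lattice wt"
    by (rule torsion_mod_lattice)
  have "(x $ v) ^ k = (x $ s) ^ k" if "p \<in> zeros" "x \<in> p" "x \<noteq> 0" for p x
  proof -
    have "monom_at (Poly_Mapping.single v k) x = monom_at (Poly_Mapping.single s k) x"
      using that L unfolding zeros_iff by simp
    then show ?thesis by (simp add: monom_at_single)
  qed
  with k show ?thesis by (rule that)
qed

text \<open>A power of each coordinate equals that power of the coordinate at the sink, so if one coordinate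
  were \<open>0\<close>, all of them would be.\<close>
lemma zeros_in_torus:
  assumes "p \<in> zeros" and "x \<in> p" and "x \<noteq> 0"
  shows "x $ v \<noteq> 0"
proof -
  have eq: "x $ w = 0 \<longleftrightarrow> x $ s = 0" for w
  proof -
    obtain k where "k > 0" "(x $ w) ^ k = (x $ s) ^ k"
      using zeros_coordinates[of w] assms by metis
    then show ?thesis by (metis power_eq_0_iff)
  qed
  have "\<exists>w. x $ w \<noteq> 0"
    using assms(3) by (auto simp: vec_eq_iff)
  with eq show ?thesis by blast
qed

text \<open>Scaled to have coordinate \<open>1\<close> at the sink, a zero has a root of unity of bounded order in each
  coordinate.\<close>
lemma finite_zeros: "finite zeros"
proof -
  have "\<exists>k>0. \<forall>p x. p \<in> zeros \<longrightarrow> x \<in> p \<longrightarrow> x \<noteq> 0 \<longrightarrow> (x $ v) ^ k = (x $ s) ^ k" for v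
    by (rule zeros_coordinates[of v]) blast
  then obtain k :: "'v \<Rightarrow> nat" where k: "\<And>v. k v > 0"
    and pow: "\<And>v p x. p \<in> zeros \<Longrightarrow> x \<in> p \<Longrightarrow> x \<noteq> 0 \<Longrightarrow> (x $ v) ^ k v = (x $ s) ^ k v"
    by metis
  let ?F = "PiE UNIV (\<lambda>v. {z :: complex. z ^ k v = 1})"
  have "finite ?F"
    using k by (intro finite_PiE finite_roots_unity) (auto simp: Suc_le_eq)
  moreover have "zeros \<subseteq> (\<lambda>h. vec.span {\<chi> v. h v}) ` ?F"
  proof
    fix p assume p: "p \<in> zeros"
    then have "p \<in> projective_space" by (simp add: zeros_iff)
    then obtain x where x: "p = vec.span {x}" "x \<noteq> 0" "x \<in> p" by (rule line_rep)
    have xs: "x $ s \<noteq> 0"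
      using p x by (intro zeros_in_torus)
    define y where "y = (1 / x $ s) *s x"
    have y: "y \<in> p" "y $ s = 1"
      using x xs by (auto simp: y_def vec.span_scale)
    then have "y \<noteq> 0" by auto
    have "(y $ v) ^ k v = 1" for v
      using pow[OF p y(1) \<open>y \<noteq> 0\<close>, of v] y(2) by simp
    moreover have "p = vec.span {y}"
      using y(1) \<open>y \<noteq> 0\<close> x(1) span_line_eq by blast
    ultimately show "p \<in> (\<lambda>h. vec.span {\<chi> v. h v}) ` ?F"
      by (intro image_eqI[of _ _ "\<lambda>v. y $ v"]) (auto simp: vec_lambda_eta)
  qed
  ultimately show ?thesis
    by (rule finite_surj)
qed

text \<open>The characters of the quotient of \<open>\<int>V\<close> by the lattice form a group under coordinatewise
  multiplication. Hence every such \<open>t\<close> acts on the zero set.\<close>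
lemma zeros_hadamard:
  assumes r: "r \<in> zeros" "z \<in> r" "z \<noteq> 0"
    and t: "\<And>v. t $ v \<noteq> 0"
      "\<And>u v. Poly_Mapping.map int u - Poly_Mapping.map int v \<in> laplacian_lattice wt
        \<Longrightarrow> monom_at u t = monom_at v t"
  shows "hadamard t z \<noteq> 0" and "vec.span {hadamard t z} \<in> zeros"
proof -
  show nz: "hadamard t z \<noteq> 0"
    using r(3) t(1) by (auto simp: hadamard_def vec_eq_iff)
  have "monom_at u w = monom_at v w"
    if w: "w \<in> vec.span {hadamard t z} - {0}"
      and uv: "Poly_Mapping.map int u - Poly_Mapping.map int v \<in> laplacian_lattice wt" for w u v
  proof -
    obtain c where c: "w = c *s hadamard t z" "c \<noteq> 0"
      using w by (auto simp: vec.span_singleton)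
    have "r \<in> projective_space"
      using r(1) by (simp add: zeros_iff)
    then have "c *s z \<in> r"
      using r(2) by (auto simp: projective_space_def vec.span_scale)
    moreover have "c *s z \<noteq> 0"
      using c r(3) by simp
    ultimately have "monom_at u (c *s z) = monom_at v (c *s z)"
      using r(1) uv unfolding zeros_iff by blast
    moreover have "w = hadamard t (c *s z)"
      by (simp add: c hadamard_def vec_eq_iff)
    ultimately show ?thesis
      using t(2)[OF uv] by (simp only: monom_at_hadamard)
  qed
  then show "vec.span {hadamard t z} \<in> zeros"
    using nz unfolding zeros_iff by (auto simp: projective_space_def)
qed

text \<open>The quotient \<open>t = y / x\<close> of representatives of \<open>q\<close> and \<open>p\<close> acts on the zero set and takes \<open>p\<close>
  to \<open>q\<close>. Composing a separator of \<open>q\<close> with this action yields a separator of \<open>p\<close>.\<close>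
lemma zeros_separator_transfer:
  assumes p: "p \<in> zeros" and q: "q \<in> zeros" and f: "separator (zeros - {q}) q d f"
  shows "\<exists>g. separator (zeros - {p}) p d g"
proof -
  have "p \<in> projective_space" and "q \<in> projective_space"
    using p q by (simp_all add: zeros_iff)
  then obtain x y where x: "p = vec.span {x}" "x \<noteq> 0" "x \<in> p"
    and y: "q = vec.span {y}" "y \<noteq> 0" "y \<in> q"
    using line_rep by metis
  have xnz: "x $ v \<noteq> 0" and ynz: "y $ v \<noteq> 0" for v
    using zeros_in_torus[OF p x(3,2)] zeros_in_torus[OF q y(3,2)] by auto
  define t where "t = (\<chi> v. y $ v / x $ v)"
  have tnz: "t $ v \<noteq> 0" for v
    using xnz ynz by (simp add: t_def)
  have tx: "hadamard t x = y"
    using xnz by (simp add: t_def hadamard_def vec_eq_iff)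
  have t: "monom_at u t = monom_at v t"
    if uv: "Poly_Mapping.map int u - Poly_Mapping.map int v \<in> laplacian_lattice wt" for u v
  proof -
    have y_eq: "monom_at m y = monom_at m t * monom_at m x" for m
      using monom_at_hadamard[of m t x] tx by simp
    have "monom_at u x = monom_at v x" and "monom_at u y = monom_at v y"
      using p q x y uv unfolding zeros_iff by auto
    moreover have "monom_at v x \<noteq> 0"
      using xnz by (simp add: monom_at_def)
    ultimately show ?thesis by (simp add: y_eq)
  qed
  have fd: "f \<in> homogeneous_part d" and fX: "vanishes_on f (zeros - {q})"
    and fq: "\<not> vanishes_at f q"
    using f by (auto simp: separator_def)
  have "peval (dilate t f) z = 0" if r: "r \<in> zeros" "r \<noteq> p" and z: "z \<in> r" "z \<noteq> 0" for r z
  proof -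
    have tz: "hadamard t z \<noteq> 0" "vec.span {hadamard t z} \<in> zeros"
      using zeros_hadamard[OF r(1) z tnz t] by auto
    \<comment> \<open>The action of \<open>t\<close> is injective, so \<open>p\<close> is the only point sent to \<open>q\<close>.\<close>
    have "vec.span {hadamard t z} \<noteq> q"
    proof
      assume "vec.span {hadamard t z} = q"
      then have "hadamard t z \<in> vec.span {y}"
        using y(1) vec.span_base by blast
      then obtain c where "hadamard t z = c *s hadamard t x"
        by (auto simp: vec.span_singleton tx)
      then have "z = c *s x"
        using tnz by (simp add: hadamard_def vec_eq_iff)
      then have "z \<in> vec.span {x}"
        by (auto simp: vec.span_singleton)
      then have "vec.span {z} = p"
        using span_line_eq z(2) x(1) by blast
      moreover obtain w where "r = vec.span {w}"
        using r(1) by (auto simp: zeros_iff projective_space_def)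
      ultimately show False
        using span_line_eq z r(2) by blast
    qed
    with fX tz show ?thesis
      by (simp add: peval_dilate vanishes_on_def vanishes_at_def vec.span_base)
  qed
  then have "vanishes_on (dilate t f) (zeros - {p})"
    by (auto simp: vanishes_on_def vanishes_at_def)
  moreover have "\<not> vanishes_at (dilate t f) p"
    using fq vanishes_at_line[OF fd y(2)] vanishes_at_line[OF homogeneous_dilate[OF fd] x(2)]
    by (simp add: x(1) y(1) peval_dilate tx)
  ultimately show ?thesis
    using homogeneous_dilate[OF fd] by (auto simp: separator_def)
qed

theorem cayley_bacharach_zeros: "cayley_bacharach zeros"
proof (rule cayley_bacharach_if_separators_transfer)
  show "zeros \<subseteq> projective_space"
    by (auto simp: zeros_iff)
qed (use finite_zeros zeros_separator_transfer in auto)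

end

theorem proposition6p18:
  fixes E :: "('v::finite \<times> 'v) set" and wt :: "'v \<Rightarrow> 'v \<Rightarrow> nat" and s :: 'v and n :: nat
  assumes "sandpile_graph E wt s"
    and "CARD('v) = n + 1"
  shows "cayley_bacharach (projective_zeros (toppling_ideal wt))"
  using assms(1) by (rule sandpile_graph.cayley_bacharach_zeros)

end
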